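(* Let $k,m,n$ be positive integers with $m\le k$. The set of partitions in $L^k(m,n)$ is exactly the set of partitions that fit inside an $m\times n$ rectangle (i.e. have at most $n$ parts, each at most $m$) and have no more than $k-m+1$ rows (i.e. nonzero parts) shorter than $m$.
   Context: Fix an integer $k\ge1$. A partition $\lambda=(\lambda_1\ge\dots\ge\lambda_\ell>0)$ is a finite (possibly empty) non-increasing sequence of positive integers, $|\lambda|=\sum_i\lambda_i$, $\ell(\lambda)$ is the number of parts, and $\lambda_i=0$ for $i>\ell(\lambda)$. Its diagram is the set of cells $(i,j)$ with $1\le j\le\lambda_i$ (row $i$, column $j$; row 1 is the lowest row, and "above" means larger row index). $\lambda\subseteq\mu$ means $\lambda_i\le\mu_i$ for all $i$. A partition is $k$-bounded if $\lambda_1\le k$; $\mathcal P^k$ is the set of $k$-bounded partitions. $(m^n)$ is the partition with $n$ parts equal to $m$. For partitions $\rho\subseteq\gamma$, the skew diagram $\gamma/\rho$ is $\{(i,j):\rho_i<j\le\gamma_i\}$; the squares of $\rho$ are said to lie below $\gamma/\rho$. For a square $(i,j)\in\gamma$ (possibly in $\rho$), its hook-length in $\gamma/\rho$ is the number of cells of $\gamma/\rho$ of the form $(i,j')$ with $j'\ge j$ or $(i',j)$ with $i'\ge i$. For $\lambda\in\mathcal P^k$, the $k$-skew diagram $\lambda/^k$ is the unique skew diagram such that (i) row $i$ has $\lambda_i$ cells, (ii) no cell of the diagram has hook-length exceeding $k$, (iii) every square below the diagram has hook-length exceeding $k$. The column lengths of $\lambda/^k$ form a $k$-bounded partition, called the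 $k$-conjugate $\lambda^{\omega_k}$. For $\lambda,\mu\in\mathcal P^k$ write $\lambda\prec\!\!\cdot\,\mu$ when $\lambda\subseteq\mu$, $\lambda^{\omega_k}\subseteq\mu^{\omega_k}$ and $|\mu|-|\lambda|=1$. The partial order $\preceq$ on $\mathcal P^k$ is the reflexive-transitive closure of $\prec\!\!\cdot$; the resulting poset is $Y^k$. For $1\le m\le k$ and $n\ge1$, $L^k(m,n)=\{\mu\in\mathcal P^k:\mu\preceq(m^n)\}$ is the principal order ideal of $Y^k$ generated by $(m^n)$. *)

theory Defs
  imports Main
begin

text \<open>
  A partition is the list of its (positive) parts in non-increasing order. Rows and columns
  of diagrams are numbered from 1, so \<open>part \<nu> i\<close> is the usual \<open>\<nu>\<^sub>i\<close>; the convention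
  \<open>part \<nu> 0 = 0\<close> ensures that no diagram has cells in row 0.
\<close>

definition is_partition :: "nat list \<Rightarrow> bool" where
  "is_partition \<nu> \<longleftrightarrow> sorted_wrt (\<ge>) \<nu> \<and> 0 \<notin> set \<nu>"

definition part :: "nat list \<Rightarrow> nat \<Rightarrow> nat" where
  "part \<nu> i = (if 1 \<le> i \<and> i \<le> length \<nu> then \<nu> ! (i - 1) else 0)"

definition diagram :: "nat list \<Rightarrow> (nat \<times> nat) set" where
  "diagram \<nu> = {(i, j). 1 \<le> j \<and> j \<le> part \<nu> i}"

definition contained :: "nat list \<Rightarrow> nat list \<Rightarrow> bool" where
  "contained \<nu> \<mu> \<longleftrightarrow> (\<forall>i. part \<nu> i \<le> part \<mu> i)"

definition bounded_partitions :: "nat \<Rightarrow> nat list set" where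
  "bounded_partitions k = {\<nu>. is_partition \<nu> \<and> part \<nu> 1 \<le> k}"

definition skew_diagram :: "nat list \<Rightarrow> nat list \<Rightarrow> (nat \<times> nat) set" where
  "skew_diagram \<gamma> \<rho> = {(i, j). part \<rho> i < j \<and> j \<le> part \<gamma> i}"

text \<open>
  The square whose hook-length is taken may lie in \<open>\<rho>\<close>, but only cells of \<open>\<gamma>/\<rho>\<close> are counted.
\<close>

definition hook_length :: "nat list \<Rightarrow> nat list \<Rightarrow> nat \<times> nat \<Rightarrow> nat" where
  "hook_length \<gamma> \<rho> = (\<lambda>(i, j).
     card {(i', j'). (i', j') \<in> skew_diagram \<gamma> \<rho> \<and> (i' = i \<and> j \<le> j' \<or> j' = j \<and> i \<le> i')})"

definition is_k_skew :: "nat \<Rightarrow> nat list \<Rightarrow> nat list \<times> nat list \<Rightarrow> bool" where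
  "is_k_skew k \<nu> = (\<lambda>(\<gamma>, \<rho>).
     is_partition \<gamma> \<and> is_partition \<rho> \<and> contained \<rho> \<gamma> \<and>
     (\<forall>i. card {j. (i, j) \<in> skew_diagram \<gamma> \<rho>} = part \<nu> i) \<and>
     (\<forall>c \<in> skew_diagram \<gamma> \<rho>. hook_length \<gamma> \<rho> c \<le> k) \<and>
     (\<forall>c \<in> diagram \<rho>. k < hook_length \<gamma> \<rho> c))"

text \<open>
  For a \<open>k\<close>-bounded partition \<open>\<nu>\<close> the pair \<open>(\<gamma>, \<rho>)\<close> itself is unique, not only its set of cells:
  a row of \<open>\<gamma>\<close> above the last part of \<open>\<nu>\<close> would be a row of \<open>\<rho>\<close>, and in the topmost such row
  the squares have hook-length 0.
\<close>

definition k_skew :: "nat \<Rightarrow> nat list \<Rightarrow> nat list \<times> nat list" where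
  "k_skew k \<nu> = (THE p. is_k_skew k \<nu> p)"

definition k_conjugate :: "nat \<Rightarrow> nat list \<Rightarrow> nat list" where
  "k_conjugate k \<nu> = (case k_skew k \<nu> of (\<gamma>, \<rho>) \<Rightarrow>
     map (\<lambda>j. card {i. (i, j) \<in> skew_diagram \<gamma> \<rho>}) [1..<Suc (part \<gamma> 1)])"

definition weak_cover :: "nat \<Rightarrow> nat list \<Rightarrow> nat list \<Rightarrow> bool" where
  "weak_cover k \<nu> \<mu> \<longleftrightarrow> \<nu> \<in> bounded_partitions k \<and> \<mu> \<in> bounded_partitions k \<and>
     contained \<nu> \<mu> \<and> contained (k_conjugate k \<nu>) (k_conjugate k \<mu>) \<and>
     sum_list \<mu> = sum_list \<nu> + 1"

definition weak_le :: "nat \<Rightarrow> nat list \<Rightarrow> nat list \<Rightarrow> bool" where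
  "weak_le k = (weak_cover k)\<^sup>*\<^sup>*"

definition order_ideal :: "nat \<Rightarrow> nat \<Rightarrow> nat \<Rightarrow> nat list set" where
  "order_ideal k m n = {\<mu> \<in> bounded_partitions k. weak_le k \<mu> (replicate n m)}"

end

theory Submission
  imports Defs
begin

text \<open>
  Put \<open>r = k - m + 1\<close>, and call a nonempty row short if it has fewer than \<open>m\<close> cells. A partition with parts
  at most \<open>m\<close> consists of \<open>a\<close> rows of length \<open>m\<close> below a partition \<open>\<sigma>\<close> of short rows.

  The \<open>k\<close>-skew diagram \<open>\<gamma>/\<rho>\<close> of such a partition is explicit when \<open>\<sigma>\<close> has at most \<open>r + 1\<close>
  rows. The short rows are not shifted, because the hook of a short row has at most
  \<open>(m - 1) + r = k\<close> cells. A row of length \<open>m\<close> tolerates at most \<open>r - 1\<close> cells above its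
  first cell, so it is pushed to the right exactly past the end of the row that lies \<open>r\<close> rows higher:
  \<open>\<rho>\<^sub>i = \<gamma>\<^bsub>i+r\<^esub>\<close> (lemma \<open>is_k_skew_stacked\<close>). Since a \<open>k\<close>-skew diagram is determined by its row
  lengths (\<open>is_k_skew_unique\<close>), this computes the \<open>k\<close>-conjugate.

  If \<open>\<sigma>\<close> has at most \<open>r\<close> rows then \<open>\<rho>\<^sub>i = \<gamma>\<^bsub>i+r\<^esub>\<close> holds in every row, and column \<open>j\<close> of the
  diagram consists of the top \<open>r\<close> cells of column \<open>j\<close> of \<open>\<gamma>\<close>. Its length is the minimum of \<open>r\<close>
  and the length of that column of \<open>\<gamma>\<close>. As \<open>\<gamma>\<close> grows with the partition, so does the
  \<open>k\<close>-conjugate. Among these partitions the covers of \<open>Y\<^sup>k\<close> are therefore exactly the covers of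
  Young's lattice, and filling the lowest incomplete row cell by cell climbs from any of them
  to the rectangle (\<open>weak_cover_towards_rectangle\<close>).

  Conversely, the columns of the diagram of such a partition have length at most \<open>r\<close>. Removing one
  cell creates at most one new short row, and a partition with \<open>r + 1\<close> short rows has a first column
  of length at least \<open>r + 1\<close>, as none of these rows is shifted. So a step down in \<open>Y\<^sup>k\<close> from a
  partition with at most \<open>r\<close> short rows leads to another one (\<open>weak_cover_preserves_few_short_rows\<close>).
\<close>

section \<open>Parts of partitions\<close>

lemma part_0 [simp]: "part xs 0 = 0"
  by (simp add: part_def)

lemma part_beyond: "length xs < i \<Longrightarrow> part xs i = 0"
  by (simp add: part_def)

lemma part_Cons_Suc: "part (x # xs) (Suc i) = (if i = 0 then x else part xs i)"
  by (cases i) (auto simp: part_def)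

lemma part_append:
  "part (xs @ ys) i = (if i \<le> length xs then part xs i else part ys (i - length xs))"
  by (auto simp: part_def nth_append)

lemma part_replicate: "part (replicate a m) i = (if 1 \<le> i \<and> i \<le> a then m else 0)"
  by (auto simp: part_def)

lemma part_take: "part (take a xs) i = (if i \<le> a then part xs i else 0)"
  by (auto simp: part_def)

lemma part_drop: "1 \<le> i \<Longrightarrow> part (drop r xs) i = part xs (i + r)"
  by (auto simp: part_def add.commute)

lemma part_in_set: "\<lbrakk>1 \<le> i; i \<le> length xs\<rbrakk> \<Longrightarrow> part xs i \<in> set xs"
  by (auto simp: part_def)

lemma in_set_part:
  assumes "x \<in> set xs"
  obtains i where "1 \<le> i" "i \<le> length xs" "part xs i = x"
proof -
  from assms obtain i where "i < length xs" "xs ! i = x"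
    by (auto simp: in_set_conv_nth)
  then show ?thesis
    using that[of "Suc i"] by (auto simp: part_def)
qed

lemma part_le: "(\<And>x. x \<in> set xs \<Longrightarrow> x \<le> m) \<Longrightarrow> part xs i \<le> m"
  by (auto simp: part_def)

lemma is_partition_Cons:
  "is_partition (x # xs) \<longleftrightarrow> 0 < x \<and> (\<forall>y \<in> set xs. y \<le> x) \<and> is_partition xs"
  by (auto simp: is_partition_def)

lemma is_partition_replicate_append:
  assumes "is_partition xs" "\<forall>x \<in> set xs. x \<le> m" "1 \<le> m"
  shows "is_partition (replicate a m @ xs)"
  using assms by (induction a) (auto simp: is_partition_Cons)

lemma part_pos: "\<lbrakk>is_partition xs; 1 \<le> i; i \<le> length xs\<rbrakk> \<Longrightarrow> 0 < part xs i"
  using part_in_set[of i xs] by (metis is_partition_def neq0_conv)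

lemma part_antimono:
  assumes "is_partition xs" "1 \<le> i" "i \<le> j"
  shows "part xs j \<le> part xs i"
proof (cases "i = j \<or> length xs < j")
  case True
  then show ?thesis by (auto simp: part_beyond)
next
  case False
  then have "i - 1 < j - 1" "j - 1 < length xs"
    using assms by auto
  then have "xs ! (j - 1) \<le> xs ! (i - 1)"
    using assms(1) by (auto simp: is_partition_def sorted_wrt_iff_nth_less)
  then show ?thesis
    using assms False by (auto simp: part_def)
qed

lemma contained_length_le:
  assumes "is_partition xs" "contained xs ys"
  shows "length xs \<le> length ys"
proof (rule ccontr)
  assume "\<not> length xs \<le> length ys"
  then have "0 < part xs (length xs)" "part ys (length xs) = 0"
    using part_pos[OF assms(1), of "length xs"] by (auto simp: part_beyond)
  then show False
    using assms(2) by (auto simp: contained_def dest: spec[of _ "length xs"])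
qed

lemma partition_eqI:
  assumes "is_partition xs" "is_partition ys" "\<And>i. part xs i = part ys i"
  shows "xs = ys"
proof (rule nth_equalityI)
  show "length xs = length ys"
    using contained_length_le[of xs ys] contained_length_le[of ys xs] assms
    by (simp add: contained_def)
  fix i assume "i < length xs"
  then show "xs ! i = ys ! i"
    using assms(3)[of "Suc i"] \<open>length xs = length ys\<close> by (simp add: part_def)
qed

lemma sum_list_map_eq_sum_part:
  assumes "f 0 = (0::nat)" "length xs \<le> N"
  shows "sum_list (map f xs) = (\<Sum>i = 1..N. f (part xs i))"
  using assms(2)
proof (induction xs arbitrary: N)
  case Nil
  then show ?case using assms(1) by (simp add: part_beyond)
next
  case (Cons x xs)
  then obtain M where N: "N = Suc M" "length xs \<le> M"
    by (cases N) auto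
  have "(\<Sum>i = 1..N. f (part (x # xs) i)) = (\<Sum>i = 0..M. f (part (x # xs) (Suc i)))"
    unfolding N using sum.shift_bounds_cl_Suc_ivl[of "\<lambda>i. f (part (x # xs) i)" 0 M] by simp
  also have "\<dots> = f x + (\<Sum>i = 1..M. f (part xs i))"
    by (simp add: part_Cons_Suc sum.atLeast_Suc_atMost)
  finally show ?case
    using Cons.IH[OF N(2)] by simp
qed

section \<open>Hook-lengths and uniqueness of the k-skew diagram\<close>

lemma finite_rows_reaching: "1 \<le> j \<Longrightarrow> finite {i. j \<le> part xs i}"
  by (rule finite_subset[of _ "{..length xs}"]) (auto simp: part_def split: if_splits)

lemma finite_column: "finite {i. P i \<and> part xs i < j \<and> j \<le> part ys i}"
  by (rule finite_subset[of _ "{..length ys}"]) (auto simp: part_def split: if_splits)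

lemma hook_length_eq:
  assumes "1 \<le> j"
  shows "hook_length \<gamma> \<rho> (i, j) =
    (part \<gamma> i - max (part \<rho> i) (j - 1)) + card {i'. i < i' \<and> part \<rho> i' < j \<and> j \<le> part \<gamma> i'}"
proof -
  let ?R = "{max (part \<rho> i) (j - 1)<..part \<gamma> i}"
  let ?C = "{i'. i < i' \<and> part \<rho> i' < j \<and> j \<le> part \<gamma> i'}"
  have "{(i', j'). (i', j') \<in> skew_diagram \<gamma> \<rho> \<and> (i' = i \<and> j \<le> j' \<or> j' = j \<and> i \<le> i')} =
      Pair i ` ?R \<union> (\<lambda>i'. (i', j)) ` ?C"
    using assms by (auto simp: skew_diagram_def image_iff)
  moreover have "card (Pair i ` ?R \<union> (\<lambda>i'. (i', j)) ` ?C) =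
      card (Pair i ` ?R) + card ((\<lambda>i'. (i', j)) ` ?C)"
    by (rule card_Un_disjoint) (auto intro: finite_column)
  ultimately show ?thesis
    by (simp add: hook_length_def card_image inj_on_def)
qed

lemma card_row: "card {j. (i, j) \<in> skew_diagram \<gamma> \<rho>} = part \<gamma> i - part \<rho> i"
proof -
  have "{j. (i, j) \<in> skew_diagram \<gamma> \<rho>} = {part \<rho> i<..part \<gamma> i}"
    by (auto simp: skew_diagram_def)
  then show ?thesis by simp
qed

lemma is_k_skew_part:
  assumes "is_k_skew k \<nu> (\<gamma>, \<rho>)"
  shows "part \<gamma> i = part \<rho> i + part \<nu> i"
proof -
  have "part \<rho> i \<le> part \<gamma> i" "part \<gamma> i - part \<rho> i = part \<nu> i"
    using assms by (auto simp: is_k_skew_def contained_def card_row)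
  then show ?thesis by simp
qed

text \<open>
  If two \<open>k\<close>-skew diagrams agree above row \<open>i\<close>, then the square just right of the smaller shift
  of row \<open>i\<close> sees the whole row and the same column above it in both diagrams, so it has the same
  hook-length in both; but it lies below one diagram and in the other. An empty row must not be
  shifted either, since nothing lies above it.
\<close>

lemma is_k_skew_shift_le:
  assumes \<nu>: "is_partition \<nu>"
    and skew: "is_k_skew k \<nu> (\<gamma>, \<rho>)" and skew': "is_k_skew k \<nu> (\<gamma>', \<rho>')"
    and above: "\<And>i'. i < i' \<Longrightarrow> part \<rho> i' = part \<rho>' i'"
  shows "part \<rho>' i \<le> part \<rho> i"
proof (rule ccontr)
  assume "\<not> ?thesis"
  then have less: "part \<rho> i < part \<rho>' i" by simp
  then have "1 \<le> i" by (cases i) auto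
  define j where "j = Suc (part \<rho> i)"
  define C where "C = card {i'. i < i' \<and> part \<rho> i' < j \<and> j \<le> part \<gamma> i'}"
  have "part \<gamma> i' = part \<gamma>' i'" if "i < i'" for i'
    using above[OF that] is_k_skew_part[OF skew] is_k_skew_part[OF skew'] by simp
  then have "C = card {i'. i < i' \<and> part \<rho>' i' < j \<and> j \<le> part \<gamma>' i'}"
    unfolding C_def using above by (intro arg_cong[where f = card]) auto
  then have hook': "hook_length \<gamma>' \<rho>' (i, j) = part \<nu> i + C"
    using less is_k_skew_part[OF skew', of i] by (simp add: hook_length_eq j_def max_def)
  have "(i, j) \<in> diagram \<rho>'"
    using less by (simp add: diagram_def j_def)
  then have big: "k < part \<nu> i + C"
    using skew' hook' by (auto simp: is_k_skew_def)
  show False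
  proof (cases "part \<nu> i = 0")
    case True
    have "part \<nu> i' = 0" if "i < i'" for i'
      using part_antimono[OF \<nu> \<open>1 \<le> i\<close>, of i'] True that by simp
    then have "C = 0"
      using is_k_skew_part[OF skew] by (auto simp: C_def card_eq_0_iff)
    then show False using True big by simp
  next
    case False
    then have "(i, j) \<in> skew_diagram \<gamma> \<rho>"
      using is_k_skew_part[OF skew, of i] by (simp add: skew_diagram_def j_def)
    then have "hook_length \<gamma> \<rho> (i, j) \<le> k"
      using skew by (auto simp: is_k_skew_def)
    moreover have "hook_length \<gamma> \<rho> (i, j) = part \<nu> i + C"
      using is_k_skew_part[OF skew, of i] by (simp add: hook_length_eq j_def C_def)
    ultimately show False using big by simp
  qed
qed

lemma is_k_skew_unique:
  assumes \<nu>: "is_partition \<nu>"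
    and skew: "is_k_skew k \<nu> (\<gamma>, \<rho>)" and skew': "is_k_skew k \<nu> (\<gamma>', \<rho>')"
  shows "\<gamma> = \<gamma>' \<and> \<rho> = \<rho>'"
proof -
  define N where "N = max (length \<rho>) (length \<rho>')"
  have \<rho>: "part \<rho> i = part \<rho>' i" for i
  proof (induction "N - i" arbitrary: i rule: less_induct)
    case less
    show ?case
    proof (cases "N < i")
      case True
      then show ?thesis by (simp add: N_def part_beyond)
    next
      case False
      have above: "part \<rho> i' = part \<rho>' i'" if "i < i'" for i'
        using less[of i'] that False by (cases "N < i'") (auto simp: N_def part_beyond)
      show ?thesis
      proof (rule antisym)
        show "part \<rho> i \<le> part \<rho>' i"
          using above by (intro is_k_skew_shift_le[OF \<nu> skew' skew]) simp
        show "part \<rho>' i \<le> part \<rho> i"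
          using above by (intro is_k_skew_shift_le[OF \<nu> skew skew']) simp
      qed
    qed
  qed
  then have "part \<gamma> i = part \<gamma>' i" for i
    using is_k_skew_part[OF skew] is_k_skew_part[OF skew'] by simp
  with \<rho> show ?thesis
    using skew skew' by (auto simp: is_k_skew_def intro: partition_eqI)
qed

lemma k_skew_eqI:
  assumes "is_partition \<nu>" "is_k_skew k \<nu> (\<gamma>, \<rho>)"
  shows "k_skew k \<nu> = (\<gamma>, \<rho>)"
  unfolding k_skew_def
proof (rule the_equality)
  fix p assume "is_k_skew k \<nu> p"
  then show "p = (\<gamma>, \<rho>)"
    using is_k_skew_unique[OF assms, of "fst p" "snd p"] by (cases p) simp
qed (fact assms(2))

lemma part_k_conjugate:
  assumes "is_partition \<nu>" and skew: "is_k_skew k \<nu> (\<gamma>, \<rho>)" and "1 \<le> j"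
  shows "part (k_conjugate k \<nu>) j = card {i. part \<rho> i < j \<and> j \<le> part \<gamma> i}"
proof (cases "j \<le> part \<gamma> 1")
  case True
  then have "[1..<Suc (part \<gamma> 1)] ! (j - 1) = j"
    using \<open>1 \<le> j\<close> nth_upt[of 1 "j - 1" "Suc (part \<gamma> 1)"] by simp
  then show ?thesis
    using True \<open>1 \<le> j\<close> by (simp add: k_conjugate_def k_skew_eqI[OF assms(1,2)]
      part_def[of "map _ _"] skew_diagram_def del: upt_Suc)
next
  case False
  have "is_partition \<gamma>" using skew by (simp add: is_k_skew_def)
  then have "part \<gamma> i < j" for i
    using False \<open>1 \<le> j\<close> part_antimono[of \<gamma> 1 i] by (cases "i = 0") auto
  then have "{i. part \<rho> i < j \<and> j \<le> part \<gamma> i} = {}"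
    by (auto simp: not_le)
  then have "card {i. part \<rho> i < j \<and> j \<le> part \<gamma> i} = 0"
    by (simp only: card.empty)
  then show ?thesis
    using False by (simp add: k_conjugate_def k_skew_eqI[OF assms(1,2)] part_def[of "map _ _"]
      del: upt_Suc)
qed

section \<open>The k-skew diagram of full rows below short rows\<close>

text \<open>
  The outer partition of the \<open>k\<close>-skew diagram of \<open>replicate a m @ \<sigma>\<close>, built from the top row
  downwards. The new bottom row starts behind the end of the row that lies \<open>r\<close> rows
  higher, which is row \<open>r\<close> of the diagram built so far.
\<close>

primrec stacked_outer :: "nat \<Rightarrow> nat \<Rightarrow> nat list \<Rightarrow> nat \<Rightarrow> nat list" where
  "stacked_outer m r \<sigma> 0 = \<sigma>"
| "stacked_outer m r \<sigma> (Suc a) = (m + part (stacked_outer m r \<sigma> a) r) # stacked_outer m r \<sigma> a"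

text \<open>
  Only the \<open>a\<close> full rows are shifted; without the truncation to \<open>a\<close> rows, a short row would be
  shifted too when there are more than \<open>r\<close> of them.
\<close>

definition stacked_inner :: "nat \<Rightarrow> nat \<Rightarrow> nat list \<Rightarrow> nat \<Rightarrow> nat list" where
  "stacked_inner m r \<sigma> a = take a (drop r (stacked_outer m r \<sigma> a))"

definition short_rows :: "nat \<Rightarrow> nat list \<Rightarrow> bool" where
  "short_rows m \<sigma> \<longleftrightarrow> is_partition \<sigma> \<and> (\<forall>p \<in> set \<sigma>. p < m)"

lemma length_stacked_outer [simp]: "length (stacked_outer m r \<sigma> a) = a + length \<sigma>"
  by (induction a) auto

text \<open>
  Two consecutive full rows start behind the rows that lie \<open>r\<close> higher, which are themselves
  consecutive rows of the smaller diagram; so the lower row is shifted at least as far. The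
  lowest short row is no problem for the full row below it, as it is shorter and not shifted.
\<close>

lemma is_partition_stacked_outer:
  assumes \<sigma>: "short_rows m \<sigma>" and "1 \<le> m" "1 \<le> r"
  shows "is_partition (stacked_outer m r \<sigma> a)"
proof (induction a)
  case 0
  then show ?case using \<sigma> by (simp add: short_rows_def)
next
  case (Suc a)
  let ?G = "stacked_outer m r \<sigma> a"
  have "y \<le> m + part ?G r" if y: "y \<in> set ?G" for y
  proof (cases a)
    case 0
    then show ?thesis using y \<sigma> by (auto simp: short_rows_def)
  next
    case (Suc b)
    let ?H = "stacked_outer m r \<sigma> b"
    have "y \<le> m + part ?H r"
      using y Suc.IH unfolding Suc by (auto simp: is_partition_Cons)
    also have "part ?H r = part ?G (Suc r)"
      using \<open>1 \<le> r\<close> by (simp add: Suc part_Cons_Suc)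
    also have "part ?G (Suc r) \<le> part ?G r"
      using part_antimono[OF Suc.IH \<open>1 \<le> r\<close>] by simp
    finally show ?thesis by simp
  qed
  then show ?case using Suc.IH \<open>1 \<le> m\<close> by (simp add: is_partition_Cons)
qed

lemma part_stacked_outer_full:
  assumes "1 \<le> r" "1 \<le> i" "i \<le> a"
  shows "part (stacked_outer m r \<sigma> a) i = m + part (stacked_outer m r \<sigma> a) (i + r)"
  using assms(2,3)
proof (induction a arbitrary: i)
  case (Suc a)
  show ?case
  proof (cases "i = 1")
    case True
    then show ?thesis using \<open>1 \<le> r\<close> by (simp add: part_Cons_Suc)
  next
    case False
    then obtain i' where "i = Suc i'" "1 \<le> i'" "i' \<le> a"
      using Suc.prems by (cases i) auto
    then show ?thesis using Suc.IH[of i'] by (simp add: part_Cons_Suc)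
  qed
qed simp

lemma part_stacked_outer_short:
  assumes "a < i"
  shows "part (stacked_outer m r \<sigma> a) i = part \<sigma> (i - a)"
  using assms
proof (induction a arbitrary: i)
  case (Suc a)
  then obtain i' where "i = Suc i'" "a < i'" by (cases i) auto
  then show ?case using Suc.IH[of i'] by (simp add: part_Cons_Suc)
qed simp

lemma part_stacked_inner:
  "part (stacked_inner m r \<sigma> a) i =
    (if 1 \<le> i \<and> i \<le> a then part (stacked_outer m r \<sigma> a) (i + r) else 0)"
  by (cases "i = 0") (auto simp: stacked_inner_def part_take part_drop)

lemma part_full_and_short:
  "part (replicate a m @ \<sigma>) i = (if i = 0 then 0 else if i \<le> a then m else part \<sigma> (i - a))"
  by (auto simp: part_append part_replicate)

lemma part_stacked_outer_eq:
  assumes "1 \<le> r"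
  shows "part (stacked_outer m r \<sigma> a) i =
    part (replicate a m @ \<sigma>) i + part (stacked_inner m r \<sigma> a) i"
  using part_stacked_outer_full[OF assms, of i a m \<sigma>] part_stacked_outer_short[of a i m r \<sigma>]
  by (cases "i = 0") (auto simp: part_stacked_inner part_full_and_short)

lemma is_partition_stacked_inner:
  assumes "short_rows m \<sigma>" "1 \<le> m" "1 \<le> r"
  shows "is_partition (stacked_inner m r \<sigma> a)"
  using is_partition_stacked_outer[OF assms, of a]
  by (auto simp: stacked_inner_def is_partition_def sorted_wrt_take sorted_wrt_drop
    dest: in_set_takeD in_set_dropD)

lemma card_nat_interval_le:
  assumes "A \<subseteq> {a..<b::nat}"
  shows "card A \<le> b - a"
  using card_mono[OF _ assms] by simp

text \<open>
  The bound \<open>r + 1\<close> on the number of short rows is what keeps the hooks of the unshifted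
  short rows within \<open>k = (m - 1) + r\<close>.
\<close>

lemma stacked_hook_le:
  assumes \<sigma>: "short_rows m \<sigma>" "length \<sigma> \<le> r + 1" and "1 \<le> m" "1 \<le> r" "k + 1 = m + r"
    and cell: "(i, j) \<in> skew_diagram (stacked_outer m r \<sigma> a) (stacked_inner m r \<sigma> a)"
  shows "hook_length (stacked_outer m r \<sigma> a) (stacked_inner m r \<sigma> a) (i, j) \<le> k"
proof -
  define g where "g = part (stacked_outer m r \<sigma> a)"
  define p where "p = part (stacked_inner m r \<sigma> a)"
  have j: "p i < j" "j \<le> g i"
    using cell by (auto simp: skew_diagram_def g_def p_def)
  then have i: "1 \<le> i" by (cases i) (auto simp: g_def)
  have row: "g i = part (replicate a m @ \<sigma>) i + p i"
    using part_stacked_outer_eq[OF \<open>1 \<le> r\<close>] by (simp add: g_def p_def)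
  define C where "C = {i'. i < i' \<and> p i' < j \<and> j \<le> g i'}"
  have anti: "g i'' \<le> g i'" if "1 \<le> i'" "i' \<le> i''" for i' i''
    using part_antimono[OF is_partition_stacked_outer[OF \<sigma>(1) \<open>1 \<le> m\<close> \<open>1 \<le> r\<close>]] that
    by (simp add: g_def)
  have "hook_length (stacked_outer m r \<sigma> a) (stacked_inner m r \<sigma> a) (i, j) =
      (g i - max (p i) (j - 1)) + card C"
    using j by (simp add: hook_length_eq g_def p_def C_def)
  also have "\<dots> \<le> part (replicate a m @ \<sigma>) i + card C"
    using row by simp
  also have "\<dots> \<le> k"
  proof (cases "i \<le> a")
    case True
    then have "p i = g (i + r)"
      using i by (simp add: p_def g_def part_stacked_inner)
    then have "\<not> i + r \<le> i'" if "i' \<in> C" for i'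
      using that j anti[of "i + r" i'] i by (auto simp: C_def)
    then have "C \<subseteq> {Suc i..<i + r}"
      by (auto simp: C_def not_le)
    then have "card C \<le> r - 1"
      using card_nat_interval_le[of C "Suc i" "i + r"] by simp
    then show ?thesis
      using True i \<open>k + 1 = m + r\<close> \<open>1 \<le> r\<close> by (simp add: part_full_and_short)
  next
    case False
    have "p i = 0" using False by (simp add: p_def part_stacked_inner)
    then have "0 < part \<sigma> (i - a)"
      using row j False i by (simp add: part_full_and_short)
    then have "1 \<le> i - a" "i - a \<le> length \<sigma>"
      by (auto simp: part_def split: if_splits)
    then have "part \<sigma> (i - a) < m"
      using part_in_set[of "i - a" \<sigma>] \<sigma>(1) by (auto simp: short_rows_def)
    moreover have "C \<subseteq> {Suc i..<Suc (a + length \<sigma>)}"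
    proof
      fix i' assume i': "i' \<in> C"
      then have "0 < part (stacked_outer m r \<sigma> a) i'"
        using j by (auto simp: C_def g_def)
      then show "i' \<in> {Suc i..<Suc (a + length \<sigma>)}"
        using i' by (auto simp: part_def C_def split: if_splits)
    qed
    then have "card C \<le> Suc (a + length \<sigma>) - Suc i"
      by (rule card_nat_interval_le)
    ultimately show ?thesis
      using False i \<sigma>(2) \<open>k + 1 = m + r\<close> by (simp add: part_full_and_short)
  qed
  finally show ?thesis .
qed

text \<open>
  A column that passes through \<open>\<rho>\<close> in row \<open>i\<close> reaches up at least \<open>r\<close> rows further, and its
  topmost \<open>r\<close> cells belong to the skew diagram. Together with the \<open>m\<close> cells of row \<open>i\<close> they form
  a hook of more than \<open>k\<close> cells.
\<close>

lemma stacked_hook_gt: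
  assumes \<sigma>: "short_rows m \<sigma>" and "1 \<le> m" "1 \<le> r" "k + 1 = m + r"
    and square: "(i, j) \<in> diagram (stacked_inner m r \<sigma> a)"
  shows "k < hook_length (stacked_outer m r \<sigma> a) (stacked_inner m r \<sigma> a) (i, j)"
proof -
  define g where "g = part (stacked_outer m r \<sigma> a)"
  define p where "p = part (stacked_inner m r \<sigma> a)"
  have j: "1 \<le> j" "j \<le> p i"
    using square by (auto simp: diagram_def p_def)
  then have i: "1 \<le> i" "i \<le> a"
    by (auto simp: p_def part_stacked_inner split: if_splits)
  then have pi: "p i = g (i + r)"
    by (simp add: p_def g_def part_stacked_inner)
  have row: "g i = m + p i"
    using part_stacked_outer_eq[OF \<open>1 \<le> r\<close>, of m \<sigma> a i] i
    by (simp add: g_def p_def part_full_and_short)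
  have anti: "g i'' \<le> g i'" if "1 \<le> i'" "i' \<le> i''" for i' i''
    using part_antimono[OF is_partition_stacked_outer[OF \<sigma> \<open>1 \<le> m\<close> \<open>1 \<le> r\<close>]] that
    by (simp add: g_def)
  define T where "T = {i. j \<le> g i}"
  have "finite T"
    using j by (simp add: T_def g_def finite_rows_reaching)
  \<comment> \<open>the topmost row that column \<open>j\<close> reaches\<close>
  define t where "t = Max T"
  have "i + r \<in> T" using j pi by (simp add: T_def)
  then have t: "i + r \<le> t" "j \<le> g t"
    using Max_ge[OF \<open>finite T\<close>] Max_in[OF \<open>finite T\<close>] by (auto simp: t_def T_def)
  have top: "g i' < j" if "t < i'" for i'
    using Max_ge[OF \<open>finite T\<close>, of i'] that unfolding t_def[symmetric]
    by (fastforce simp: T_def not_le[symmetric])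
  define C where "C = {i'. i < i' \<and> p i' < j \<and> j \<le> g i'}"
  have "{t - r<..t} \<subseteq> C"
  proof
    fix i' assume i': "i' \<in> {t - r<..t}"
    then have "i < i'" "j \<le> g i'" using t anti[of i' t] by auto
    moreover have "p i' < j"
      using top[of "i' + r"] i' j by (auto simp: p_def g_def part_stacked_inner)
    ultimately show "i' \<in> C" by (simp add: C_def)
  qed
  moreover have "finite C"
    by (simp add: C_def p_def g_def finite_column)
  ultimately have "r \<le> card C"
    using card_mono[of C "{t - r<..t}"] t by simp
  moreover have "hook_length (stacked_outer m r \<sigma> a) (stacked_inner m r \<sigma> a) (i, j) = m + card C"
    using j row hook_length_eq[OF j(1), of "stacked_outer m r \<sigma> a" "stacked_inner m r \<sigma> a" i]
    by (simp add: g_def p_def C_def max_def)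
  ultimately show ?thesis
    using \<open>k + 1 = m + r\<close> by simp
qed

lemma is_k_skew_stacked:
  assumes "short_rows m \<sigma>" "length \<sigma> \<le> r + 1" "1 \<le> m" "1 \<le> r" "k + 1 = m + r"
  shows "is_k_skew k (replicate a m @ \<sigma>) (stacked_outer m r \<sigma> a, stacked_inner m r \<sigma> a)"
proof -
  have "part (stacked_inner m r \<sigma> a) i \<le> part (stacked_outer m r \<sigma> a) i" for i
    by (simp add: part_stacked_outer_eq[OF assms(4)])
  then show ?thesis
    unfolding is_k_skew_def
    using assms stacked_hook_le[OF assms] stacked_hook_gt[OF assms(1,3-5)]
    by (auto simp: is_partition_stacked_outer is_partition_stacked_inner contained_def card_row
      part_stacked_outer_eq[OF assms(4)])
qed

section \<open>Column lengths\<close>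

lemma is_partition_full_and_short:
  assumes "short_rows m \<sigma>" "1 \<le> m"
  shows "is_partition (replicate a m @ \<sigma>)"
  using assms by (intro is_partition_replicate_append) (auto simp: short_rows_def less_imp_le)

lemma part_k_conjugate_stacked:
  assumes "short_rows m \<sigma>" "length \<sigma> \<le> r + 1" "1 \<le> m" "1 \<le> r" "k + 1 = m + r" "1 \<le> j"
  shows "part (k_conjugate k (replicate a m @ \<sigma>)) j =
    card {i. part (stacked_inner m r \<sigma> a) i < j \<and> j \<le> part (stacked_outer m r \<sigma> a) i}"
  by (rule part_k_conjugate[OF is_partition_full_and_short[OF assms(1,3)]
        is_k_skew_stacked[OF assms(1-5)] assms(6)])

text \<open>
  A column of a partition that reaches up to row \<open>h\<close> meets row \<open>i\<close> but not row \<open>i + r\<close> exactly when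
  \<open>h - r < i \<le> h\<close>.
\<close>

lemma card_column_top_rows:
  assumes \<gamma>: "is_partition \<gamma>" and "1 \<le> j"
  shows "card {i. 1 \<le> i \<and> part \<gamma> (i + r) < j \<and> j \<le> part \<gamma> i} = min r (card {i. j \<le> part \<gamma> i})"
proof -
  define T where "T = {i. j \<le> part \<gamma> i}"
  have "finite T"
    using \<open>1 \<le> j\<close> by (simp add: T_def finite_rows_reaching)
  define h where "h = (if T = {} then 0 else Max T)"
  have "T = {1..h}"
  proof
    show "T \<subseteq> {1..h}"
      using \<open>finite T\<close> \<open>1 \<le> j\<close> by (auto simp: h_def T_def part_def split: if_splits)
    show "{1..h} \<subseteq> T"
      using Max_in[OF \<open>finite T\<close>] part_antimono[OF \<gamma>]
      by (fastforce simp: h_def T_def split: if_splits intro: order_trans)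
  qed
  then have in_T: "j \<le> part \<gamma> i \<longleftrightarrow> 1 \<le> i \<and> i \<le> h" for i
    by (auto simp: T_def set_eq_iff)
  have "{i. 1 \<le> i \<and> part \<gamma> (i + r) < j \<and> j \<le> part \<gamma> i} = {h - r<..h}"
    by (auto simp: not_le[symmetric] in_T)
  then show ?thesis
    using \<open>T = {1..h}\<close> by (auto simp: T_def)
qed

text \<open>
  With at most \<open>r\<close> short rows there is no row \<open>i + r\<close> above a short row \<open>i\<close>, so the rule for the
  shift of a full row gives the right value \<open>0\<close> for the short rows as well.
\<close>

lemma part_stacked_inner_few_short:
  assumes "length \<sigma> \<le> r" "1 \<le> i"
  shows "part (stacked_inner m r \<sigma> a) i = part (stacked_outer m r \<sigma> a) (i + r)"
  using assms by (auto simp: part_stacked_inner part_beyond)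

lemma part_k_conjugate_few_short:
  assumes "short_rows m \<sigma>" "length \<sigma> \<le> r" "1 \<le> m" "1 \<le> r" "k + 1 = m + r" "1 \<le> j"
  shows "part (k_conjugate k (replicate a m @ \<sigma>)) j =
    min r (card {i. j \<le> part (stacked_outer m r \<sigma> a) i})"
proof -
  let ?\<gamma> = "stacked_outer m r \<sigma> a"
  have "{i. part (stacked_inner m r \<sigma> a) i < j \<and> j \<le> part ?\<gamma> i} =
      {i. 1 \<le> i \<and> part ?\<gamma> (i + r) < j \<and> j \<le> part ?\<gamma> i}" (is "?A = ?B")
  proof (rule set_eqI)
    fix i show "i \<in> ?A \<longleftrightarrow> i \<in> ?B"
      using assms(2,6) by (cases "i = 0") (auto simp: part_stacked_inner_few_short)
  qed
  moreover have "is_partition ?\<gamma>"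
    using assms by (intro is_partition_stacked_outer)
  ultimately show ?thesis
    using assms part_k_conjugate_stacked[of m \<sigma> r k j a] card_column_top_rows[of ?\<gamma> j r] by simp
qed

text \<open>
  From the top row downwards, by \<open>\<gamma>\<^sub>i = \<mu>\<^sub>i + \<gamma>\<^bsub>i+r\<^esub>\<close>: both the row length and the shift can only
  grow with \<open>\<mu>\<close>.
\<close>

lemma stacked_outer_mono:
  assumes "contained (replicate a m @ \<sigma>) (replicate b m @ \<tau>)" "length \<sigma> \<le> r" "length \<tau> \<le> r" "1 \<le> r"
  shows "part (stacked_outer m r \<sigma> a) i \<le> part (stacked_outer m r \<tau> b) i"
proof (induction "Suc (a + length \<sigma>) - i" arbitrary: i rule: less_induct)
  case less
  show ?case
  proof (cases "1 \<le> i \<and> i \<le> a + length \<sigma>")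
    case True
    then have "Suc (a + length \<sigma>) - (i + r) < Suc (a + length \<sigma>) - i"
      using \<open>1 \<le> r\<close> by linarith
    then have "part (stacked_outer m r \<sigma> a) (i + r) \<le> part (stacked_outer m r \<tau> b) (i + r)"
      by (rule less)
    then show ?thesis
      using True assms(1) by (simp add: part_stacked_outer_eq[OF \<open>1 \<le> r\<close>, of _ _ _ i]
        part_stacked_inner_few_short[OF assms(2)] part_stacked_inner_few_short[OF assms(3)]
        contained_def add_mono)
  next
    case False
    then show ?thesis by (cases "i = 0") (auto simp: part_beyond)
  qed
qed

lemma k_conjugate_mono_few_short:
  assumes "contained (replicate a m @ \<sigma>) (replicate b m @ \<tau>)"
    and "short_rows m \<sigma>" "length \<sigma> \<le> r" "short_rows m \<tau>" "length \<tau> \<le> r"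
    and "1 \<le> m" "1 \<le> r" "k + 1 = m + r"
  shows "contained (k_conjugate k (replicate a m @ \<sigma>)) (k_conjugate k (replicate b m @ \<tau>))"
  unfolding contained_def
proof
  fix j
  show "part (k_conjugate k (replicate a m @ \<sigma>)) j \<le> part (k_conjugate k (replicate b m @ \<tau>)) j"
  proof (cases "j = 0")
    case False
    then have "finite {i. j \<le> part (stacked_outer m r \<tau> b) i}"
      by (simp add: finite_rows_reaching)
    moreover have "{i. j \<le> part (stacked_outer m r \<sigma> a) i} \<subseteq> {i. j \<le> part (stacked_outer m r \<tau> b) i}"
      by (intro Collect_mono impI) (erule order_trans[OF _ stacked_outer_mono[OF assms(1,3,5,7)]])
    ultimately have "card {i. j \<le> part (stacked_outer m r \<sigma> a) i} \<le>
        card {i. j \<le> part (stacked_outer m r \<tau> b) i}"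
      by (rule card_mono)
    then show ?thesis
      using False part_k_conjugate_few_short[OF assms(2,3,6-8), of j a]
        part_k_conjugate_few_short[OF assms(4,5,6-8), of j b] by simp
  qed simp
qed

text \<open>None of the \<open>r + 1\<close> short rows is shifted, so all of them meet the first column.\<close>

lemma first_column_many_short:
  assumes "short_rows m \<sigma>" "length \<sigma> = r + 1" "1 \<le> m" "1 \<le> r" "k + 1 = m + r"
  shows "r < part (k_conjugate k (replicate a m @ \<sigma>)) 1"
proof -
  let ?C = "{i. part (stacked_inner m r \<sigma> a) i < 1 \<and> 1 \<le> part (stacked_outer m r \<sigma> a) i}"
  have "{a<..a + (r + 1)} \<subseteq> ?C"
  proof
    fix i assume i: "i \<in> {a<..a + (r + 1)}"
    then have "0 < part \<sigma> (i - a)"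
      using assms(1,2) by (intro part_pos) (auto simp: short_rows_def)
    with i show "i \<in> ?C"
      by (simp add: part_stacked_inner part_stacked_outer_short)
  qed
  moreover have "finite ?C"
    using finite_column[of "\<lambda>_. True" "stacked_inner m r \<sigma> a" 1 "stacked_outer m r \<sigma> a"] by simp
  ultimately have "r + 1 \<le> card ?C"
    using card_mono[of ?C "{a<..a + (r + 1)}"] by simp
  then show ?thesis
    using assms part_k_conjugate_stacked[of m \<sigma> r k 1 a] by simp
qed

section \<open>Covers inside the ideal\<close>

definition few_short_rows :: "nat \<Rightarrow> nat \<Rightarrow> nat \<Rightarrow> nat list set" where
  "few_short_rows m r n =
    {\<mu>. is_partition \<mu> \<and> length \<mu> \<le> n \<and> (\<forall>p \<in> set \<mu>. p \<le> m) \<and> length (filter (\<lambda>p. p < m) \<mu>) \<le> r}"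

lemma full_and_short_decomposition:
  assumes "is_partition \<mu>" "\<forall>p \<in> set \<mu>. p \<le> m"
  obtains a \<sigma> where "\<mu> = replicate a m @ \<sigma>" "short_rows m \<sigma>" "\<sigma> = filter (\<lambda>p. p < m) \<mu>"
proof -
  have "\<exists>a. \<mu> = replicate a m @ filter (\<lambda>p. p < m) \<mu>"
    using assms
  proof (induction \<mu>)
    case Nil
    show ?case by simp
  next
    case (Cons x xs)
    show ?case
    proof (cases "x = m")
      case True
      obtain a where "xs = replicate a m @ filter (\<lambda>p. p < m) xs"
        using Cons by (auto simp: is_partition_Cons)
      then have "x # xs = replicate (Suc a) m @ filter (\<lambda>p. p < m) (x # xs)"
        using True by simp
      then show ?thesis by blast
    next
      case False
      then have "\<forall>p \<in> set (x # xs). p < m"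
        using Cons.prems by (fastforce simp: is_partition_Cons)
      then have "x # xs = replicate 0 m @ filter (\<lambda>p. p < m) (x # xs)"
        by simp
      then show ?thesis by blast
    qed
  qed
  then obtain a where "\<mu> = replicate a m @ filter (\<lambda>p. p < m) \<mu>" by blast
  moreover have "short_rows m (filter (\<lambda>p. p < m) \<mu>)"
    using assms(1) by (auto simp: short_rows_def is_partition_def sorted_wrt_filter)
  ultimately show thesis using that by blast
qed

lemma few_short_rows_decomposition:
  assumes "\<mu> \<in> few_short_rows m r n"
  obtains a \<sigma> where "\<mu> = replicate a m @ \<sigma>" "short_rows m \<sigma>" "length \<sigma> \<le> r" "a + length \<sigma> \<le> n"
proof -
  have \<mu>: "is_partition \<mu>" "\<forall>p \<in> set \<mu>. p \<le> m"
    using assms by (simp_all add: few_short_rows_def)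
  obtain a \<sigma> where \<sigma>: "\<mu> = replicate a m @ \<sigma>" "short_rows m \<sigma>" "\<sigma> = filter (\<lambda>p. p < m) \<mu>"
    by (rule full_and_short_decomposition[OF \<mu>])
  have "length \<sigma> \<le> r"
    unfolding \<sigma>(3) using assms by (simp add: few_short_rows_def)
  moreover have "length \<mu> = a + length \<sigma>" "length \<mu> \<le> n"
    using \<sigma>(1) assms by (simp_all add: few_short_rows_def)
  ultimately show thesis
    by (intro that[OF \<sigma>(1,2)]) simp_all
qed

lemma few_short_rows_bounded:
  assumes "\<mu> \<in> few_short_rows m r n" "m \<le> k"
  shows "\<mu> \<in> bounded_partitions k"
proof -
  have "part \<mu> 1 \<le> m"
    using assms(1) by (intro part_le) (simp add: few_short_rows_def)
  then show ?thesis
    using assms by (simp add: few_short_rows_def bounded_partitions_def)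
qed

lemma weak_cover_few_short_rows:
  assumes \<mu>: "\<mu> \<in> few_short_rows m r n" and \<nu>: "\<nu> \<in> few_short_rows m r n"
    and "contained \<mu> \<nu>" "sum_list \<nu> = sum_list \<mu> + 1"
    and "1 \<le> m" "1 \<le> r" "k + 1 = m + r"
  shows "weak_cover k \<mu> \<nu>"
proof -
  obtain a \<sigma> where \<sigma>: "\<mu> = replicate a m @ \<sigma>" "short_rows m \<sigma>" "length \<sigma> \<le> r"
    using \<mu> by (rule few_short_rows_decomposition)
  obtain b \<tau> where \<tau>: "\<nu> = replicate b m @ \<tau>" "short_rows m \<tau>" "length \<tau> \<le> r"
    using \<nu> by (rule few_short_rows_decomposition)
  have "contained (k_conjugate k \<mu>) (k_conjugate k \<nu>)"
    unfolding \<sigma>(1) \<tau>(1)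
    by (rule k_conjugate_mono_few_short) (use assms \<sigma> \<tau> in auto)
  moreover have "m \<le> k" using assms(6,7) by simp
  ultimately show ?thesis
    using assms few_short_rows_bounded by (simp add: weak_cover_def)
qed

text \<open>
  The cell goes into the lowest row with fewer than \<open>m\<close> cells. That row is short already, unless
  it is empty; then all rows below it are full, and it is the only row of the new partition that
  can be short.
\<close>

lemma weak_cover_towards_rectangle:
  assumes \<mu>: "\<mu> \<in> few_short_rows m r n" and ne: "\<mu> \<noteq> replicate n m"
    and mr: "1 \<le> m" "1 \<le> r" "k + 1 = m + r"
  obtains \<nu> where "\<nu> \<in> few_short_rows m r n" "weak_cover k \<mu> \<nu>" "sum_list \<nu> = sum_list \<mu> + 1"
proof -
  obtain a \<sigma> where \<sigma>: "\<mu> = replicate a m @ \<sigma>" "short_rows m \<sigma>"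
      and len: "length \<sigma> \<le> r" "a + length \<sigma> \<le> n"
    using \<mu> by (rule few_short_rows_decomposition)
  define \<nu> where "\<nu> = replicate a m @ (case \<sigma> of [] \<Rightarrow> [1] | x # xs \<Rightarrow> Suc x # xs)"
  have "\<nu> \<in> few_short_rows m r n \<and> contained \<mu> \<nu> \<and> sum_list \<nu> = sum_list \<mu> + 1"
  proof (cases \<sigma>)
    case Nil
    then have "a \<noteq> n" using ne \<sigma>(1) by auto
    moreover have "part \<mu> i \<le> part \<nu> i" for i
      by (simp add: \<sigma>(1) \<nu>_def Nil part_full_and_short part_append part_beyond part_replicate)
    ultimately show ?thesis
      using Nil len mr is_partition_replicate_append[of "[1]" m a] unfolding \<sigma>(1) \<nu>_def
      by (auto simp: few_short_rows_def is_partition_Cons is_partition_def[of "[]"] contained_def)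
  next
    case (Cons x xs)
    have "part (x # xs) j \<le> part (Suc x # xs) j" for j
      by (cases j) (auto simp: part_Cons_Suc)
    then have "part \<mu> i \<le> part \<nu> i" for i
      by (simp add: \<sigma>(1) \<nu>_def Cons part_append)
    moreover have top: "is_partition (Suc x # xs)" "\<forall>p \<in> set (Suc x # xs). p \<le> m"
      using \<sigma>(2) by (auto simp: Cons short_rows_def is_partition_Cons less_imp_le le_SucI)
    then have "is_partition \<nu>" "\<forall>p \<in> set \<nu>. p \<le> m"
      using is_partition_replicate_append[OF top, of a] mr by (auto simp: \<nu>_def Cons)
    moreover have "length (filter (\<lambda>p. p < m) \<nu>) \<le> length \<sigma>"
      using \<sigma>(2) by (auto simp: \<nu>_def Cons le_SucI)
    ultimately show ?thesis
      using len by (simp add: few_short_rows_def contained_def \<sigma>(1) \<nu>_def Cons)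
  qed
  then show thesis
    using that weak_cover_few_short_rows[OF \<mu>] mr by blast
qed

lemma weak_le_rectangle:
  assumes "\<mu> \<in> few_short_rows m r n" "1 \<le> m" "1 \<le> r" "k + 1 = m + r"
  shows "weak_le k \<mu> (replicate n m)"
  using assms(1)
proof (induction "n * m - sum_list \<mu>" arbitrary: \<mu> rule: less_induct)
  case less
  show ?case
  proof (cases "\<mu> = replicate n m")
    case True
    then show ?thesis by (simp add: weak_le_def)
  next
    case False
    obtain \<nu> where \<nu>: "\<nu> \<in> few_short_rows m r n" "weak_cover k \<mu> \<nu>" "sum_list \<nu> = sum_list \<mu> + 1"
      using weak_cover_towards_rectangle[OF less.prems False assms(2-4)] by blast
    have "sum_list \<nu> \<le> length \<nu> * m"
      using \<nu>(1) sum_list_mono[of \<nu> "\<lambda>x. x" "\<lambda>_. m"]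
      by (auto simp: few_short_rows_def sum_list_triv)
    also have "\<dots> \<le> n * m"
      using \<nu>(1) by (simp add: few_short_rows_def)
    finally have "weak_le k \<nu> (replicate n m)"
      using less.hyps[of \<nu>] \<nu> by simp
    then show ?thesis
      using \<nu>(2) by (simp add: weak_le_def converse_rtranclp_into_rtranclp)
  qed
qed

text \<open>
  Each cell removed makes at most one row short. In the proof this is the monotonicity, on row
  lengths up to \<open>m\<close>, of the function that adds \<open>1\<close> to the lengths of the short rows.
\<close>

lemma count_short_rows_le:
  assumes "is_partition \<mu>" "is_partition \<nu>" "contained \<mu> \<nu>" "\<forall>p \<in> set \<nu>. p \<le> m"
  shows "length (filter (\<lambda>p. p < m) \<mu>) + sum_list \<mu> \<le> length (filter (\<lambda>p. p < m) \<nu>) + sum_list \<nu>"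
proof -
  define f where "f x = x + (if 0 < x \<and> x < m then 1 else 0)" for x :: nat
  have f: "sum_list (map f xs) = length (filter (\<lambda>p. p < m) xs) + sum_list xs" if "is_partition xs" for xs
    using that by (induction xs) (auto simp: is_partition_Cons f_def)
  have "f (part \<mu> i) \<le> f (part \<nu> i)" for i
  proof -
    have "part \<mu> i \<le> part \<nu> i" "part \<nu> i \<le> m"
      using assms(3,4) part_le[of \<nu> m i] by (simp_all add: contained_def)
    then show ?thesis by (auto simp: f_def)
  qed
  then have "sum_list (map f \<mu>) \<le> sum_list (map f \<nu>)"
    using contained_length_le[OF assms(1,3)] sum_list_map_eq_sum_part[of f _ "length \<nu>"]
    by (simp add: f_def[of 0] sum_mono)
  then show ?thesis
    using f assms(1,2) by simp
qed

lemma weak_cover_preserves_few_short_rows: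
  assumes cover: "weak_cover k \<mu> \<nu>" and \<nu>: "\<nu> \<in> few_short_rows m r n"
    and mr: "1 \<le> m" "1 \<le> r" "k + 1 = m + r"
  shows "\<mu> \<in> few_short_rows m r n"
proof -
  have \<mu>: "is_partition \<mu>" "contained \<mu> \<nu>" "contained (k_conjugate k \<mu>) (k_conjugate k \<nu>)"
      "sum_list \<nu> = sum_list \<mu> + 1"
    using cover by (auto simp: weak_cover_def bounded_partitions_def)
  have \<nu>': "is_partition \<nu>" "length \<nu> \<le> n" "\<forall>p \<in> set \<nu>. p \<le> m" "length (filter (\<lambda>p. p < m) \<nu>) \<le> r"
    using \<nu> by (auto simp: few_short_rows_def)
  have le_m: "p \<le> m" if p: "p \<in> set \<mu>" for p
  proof -
    obtain i where i: "part \<mu> i = p" using p by (rule in_set_part)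
    have "part \<mu> i \<le> part \<nu> i" "part \<nu> i \<le> m"
      using \<mu>(2) part_le[of \<nu> m i] \<nu>'(3) by (simp_all add: contained_def)
    then show ?thesis using i by simp
  qed
  obtain a \<sigma> where \<sigma>: "\<mu> = replicate a m @ \<sigma>" "short_rows m \<sigma>" "\<sigma> = filter (\<lambda>p. p < m) \<mu>"
    using \<mu>(1) le_m full_and_short_decomposition by blast
  obtain b \<tau> where \<tau>: "\<nu> = replicate b m @ \<tau>" "short_rows m \<tau>" "length \<tau> \<le> r"
    using \<nu> by (rule few_short_rows_decomposition)
  have "length \<sigma> \<le> r + 1"
    using count_short_rows_le[OF \<mu>(1) \<nu>'(1) \<mu>(2) \<nu>'(3)] \<mu>(4) \<nu>'(4) \<sigma>(3) by simp
  moreover have "length \<sigma> \<noteq> r + 1"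
  proof
    assume "length \<sigma> = r + 1"
    then have "r < part (k_conjugate k \<mu>) 1"
      unfolding \<sigma>(1) using \<sigma>(2) mr by (intro first_column_many_short)
    also have "\<dots> \<le> part (k_conjugate k \<nu>) 1"
      using \<mu>(3) by (simp add: contained_def)
    also have "\<dots> \<le> r"
      unfolding \<tau>(1) using \<tau>(2,3) mr by (subst part_k_conjugate_few_short) auto
    finally show False by simp
  qed
  ultimately have "length (filter (\<lambda>p. p < m) \<mu>) \<le> r"
    using \<sigma>(3) by simp
  then show ?thesis
    using \<mu>(1) le_m contained_length_le[OF \<mu>(1,2)] \<nu>'(2) by (simp add: few_short_rows_def)
qed

lemma weak_le_preserves_few_short_rows:
  assumes "weak_le k \<mu> \<nu>" "\<nu> \<in> few_short_rows m r n" "1 \<le> m" "1 \<le> r" "k + 1 = m + r"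
  shows "\<mu> \<in> few_short_rows m r n"
  using assms(1) unfolding weak_le_def
  by (induction rule: converse_rtranclp_induct)
    (use assms(2-5) weak_cover_preserves_few_short_rows in blast)+

theorem theorem27:
  fixes k m n :: nat
  assumes "1 \<le> k" and "1 \<le> m" and "1 \<le> n" and "m \<le> k"
  shows "order_ideal k m n =
    {\<mu>. is_partition \<mu> \<and> length \<mu> \<le> n \<and> (\<forall>p \<in> set \<mu>. p \<le> m) \<and>
         length (filter (\<lambda>p. p < m) \<mu>) \<le> k - m + 1}"
proof -
  define r where "r = k - m + 1"
  have r: "1 \<le> r" "k + 1 = m + r"
    using \<open>m \<le> k\<close> by (auto simp: r_def)
  have "replicate n m \<in> few_short_rows m r n"
    using \<open>1 \<le> m\<close> is_partition_replicate_append[of "[]" m n]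
    by (auto simp: few_short_rows_def is_partition_def[of "[]"])
  then have "order_ideal k m n = few_short_rows m r n"
    using weak_le_preserves_few_short_rows weak_le_rectangle few_short_rows_bounded
      \<open>1 \<le> m\<close> \<open>m \<le> k\<close> r
    unfolding order_ideal_def by blast
  then show ?thesis
    by (simp add: few_short_rows_def r_def)
qed

end
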